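(* Let $q\in(0,1)$ and let $J_q(\,\cdot\,;a_{(J)},b)$ be any one of the three $q$-integrals $G_q(\,\cdot\,;bq^n,b)$, $I_q(\,\cdot\,;0,b)$, $R_q(\,\cdot\,;a,b)$ described in the context, with interval of integration $E_{(J)}=[a_{(J)},b]$. Let $f,g:E_{(J)}\to\mathbb{R}$ be two real functions such that $m\le f(x)\le M$ and $\varphi\le g(x)\le\Phi$ for all $x\in E_{(J)}$, where $m,M,\varphi,\Phi$ are given real constants. Then $$\left|\frac{1}{b-a_{(J)}}J_q(fg;a_{(J)},b)-\frac{1}{(b-a_{(J)})^2}J_q(f;a_{(J)},b)\,J_q(g;a_{(J)},b)\right|\le\frac14(M-m)(\Phi-\varphi).$$
   Context: Let $q\in(0,1)$. The three types of $q$-integral are: (G) restricted $q$-integral: for $b>0$, a positive integer $n$ and $a=bq^n$, $G_q(h;a,b)=b(1-q)\sum_{k=0}^{n-1}h(bq^k)q^k$; here $a_{(J)}=bq^n$. (I) for $b>0$, $I_q(h;0,b)=b(1-q)\sum_{k=0}^{\infty}h(bq^k)q^k$; here $a_{(J)}=0$. (R) Riemann-type $q$-integral: for $0<a<b$, $R_q(h;a,b)=(b-a)(1-q)\sum_{k=0}^{\infty}h\bigl(a+(b-a)q^k\bigr)q^k$; here $a_{(J)}=a$. In each case $E_{(J)}=[a_{(J)},b]$. *)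

theory Defs
  imports Complex_Main
begin

text \<open>
  Integrands are total functions, but each integral below only samples \<open>h\<close> at points of
  its own interval \<open>E\<close>, so a function given on \<open>E\<close> may be extended arbitrarily.
\<close>

text \<open>
  \<open>G_qint q n h b\<close> is \<open>G\<^sub>q(h; a, b)\<close> with \<open>a = b q\<^sup>n\<close>.  The lower limit enters the formula
  only through the number of terms \<open>n\<close>, so \<open>n\<close> is the parameter instead of \<open>a\<close>.
\<close>
definition G_qint :: "real \<Rightarrow> nat \<Rightarrow> (real \<Rightarrow> real) \<Rightarrow> real \<Rightarrow> real" where
  "G_qint q n h b = b * (1 - q) * (\<Sum>k<n. h (b * q ^ k) * q ^ k)"

definition I_qint :: "real \<Rightarrow> (real \<Rightarrow> real) \<Rightarrow> real \<Rightarrow> real" where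
  "I_qint q h b = b * (1 - q) * (\<Sum>k. h (b * q ^ k) * q ^ k)"

definition R_qint :: "real \<Rightarrow> (real \<Rightarrow> real) \<Rightarrow> real \<Rightarrow> real \<Rightarrow> real" where
  "R_qint q h a b = (b - a) * (1 - q) * (\<Sum>k. h (a + (b - a) * q ^ k) * q ^ k)"

text \<open>
  \<open>is_qint q J a b\<close>: the functional \<open>J\<close> is one of the three \<open>q\<close>-integrals, with interval of
  integration \<open>{a..b}\<close>.
\<close>
inductive is_qint :: "real \<Rightarrow> ((real \<Rightarrow> real) \<Rightarrow> real) \<Rightarrow> real \<Rightarrow> real \<Rightarrow> bool" for q :: real where
  G: "0 < b \<Longrightarrow> 0 < n \<Longrightarrow> is_qint q (\<lambda>h. G_qint q n h b) (b * q ^ n) b"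
| I: "0 < b \<Longrightarrow> is_qint q (\<lambda>h. I_qint q h b) 0 b"
| R: "0 < a \<Longrightarrow> a < b \<Longrightarrow> is_qint q (\<lambda>h. R_qint q h a b) a b"

end

theory Submission
  imports Defs
begin

text \<open>
  On bounded integrands, each of the three integrals divided by the length of its interval is a
  weighted mean \<open>h \<mapsto> (\<Sum>k. w k * h (x k))\<close> with nonnegative weights of total mass \<open>1\<close> and nodes \<open>x k\<close> in the
  interval (\<open>is_qint_weighted_mean\<close>).  The inequality is therefore Gruss' inequality for
  weighted means of bounded sequences (\<open>weighted_Gruss\<close>).

  To prove the latter, let \<open>A\<close>, \<open>B\<close> be the means of \<open>u\<close>, \<open>v\<close>, and \<open>p\<close> the midpoint of
  \<open>{m..M}\<close>.  The covariance is the mean of \<open>(u - p) * (v - B)\<close>, and \<open>\<bar>u - p\<bar> \<le> (M - m) / 2\<close>,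
  so it suffices to bound the mean of \<open>\<bar>v - B\<bar>\<close> by \<open>(\<Phi> - \<phi>) / 2\<close>.  This is trivial if \<open>\<phi> = \<Phi>\<close>.
  Otherwise, by convexity, \<open>\<bar>t - B\<bar>\<close> lies on \<open>{\<phi>..\<Phi>}\<close> below its chord (\<open>abs_diff_le_chord\<close>);
  the chord is affine in \<open>t\<close>, hence its mean is its value at \<open>t = B\<close>, which is \<open>2 * (B - \<phi>) * (\<Phi> - B) / (\<Phi> - \<phi>) \<le> (\<Phi> - \<phi>) / 2\<close>.
\<close>

lemma abs_diff_le_chord:
  fixes t c l r :: real
  assumes "l \<le> t" "t \<le> r" "l \<le> c" "c \<le> r"
  shows "(r - l) * \<bar>t - c\<bar> \<le> (c - l) * (r - t) + (r - c) * (t - l)"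
proof (cases "c \<le> t")
  case True
  have "(c - l) * (r - t) + (r - c) * (t - l) - (r - l) * (t - c) = 2 * ((c - l) * (r - t))"
    by (simp add: algebra_simps)
  with True assms show ?thesis by (smt (verit) mult_nonneg_nonneg)
next
  case False
  have "(c - l) * (r - t) + (r - c) * (t - l) - (r - l) * (c - t) = 2 * ((r - c) * (t - l))"
    by (simp add: algebra_simps)
  with False assms show ?thesis by (smt (verit) mult_nonneg_nonneg)
qed

lemma mult_diff_le_quarter_square:
  fixes c l r :: real
  shows "(c - l) * (r - c) \<le> (r - l)\<^sup>2 / 4"
proof -
  have "(r - l)\<^sup>2 / 4 - (c - l) * (r - c) = (c - (l + r) / 2)\<^sup>2"
    by (simp add: power2_eq_square field_simps)
  then show ?thesis by (smt (verit) zero_le_power2)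
qed

lemma summable_mult_bounded:
  fixes w y :: "nat \<Rightarrow> real"
  assumes "\<And>k. 0 \<le> w k" "summable w" "\<And>k. \<bar>y k\<bar> \<le> K"
  shows "summable (\<lambda>k. w k * y k)"
proof (rule summable_comparison_test)
  show "summable (\<lambda>k. K * w k)" using assms(2) by (rule summable_mult)
  have "norm (w k * y k) \<le> K * w k" for k
    using mult_right_mono[OF assms(3)[of k] assms(1)[of k]] assms(1)[of k]
    by (simp add: abs_mult mult.commute)
  then show "\<exists>N. \<forall>k\<ge>N. norm (w k * y k) \<le> K * w k" by blast
qed

text \<open>Gruss' inequality: the means of \<open>u\<close>, \<open>v\<close> and \<open>u * v\<close> are \<open>A\<close>, \<open>B\<close> and \<open>C\<close>.\<close>

theorem weighted_Gruss:
  fixes w u v :: "nat \<Rightarrow> real" and m M \<phi> \<Phi> A B C :: real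
  assumes w: "\<And>k. 0 \<le> w k" "w sums 1"
    and u: "\<And>k. m \<le> u k" "\<And>k. u k \<le> M"
    and v: "\<And>k. \<phi> \<le> v k" "\<And>k. v k \<le> \<Phi>"
    and sA: "(\<lambda>k. w k * u k) sums A"
    and sB: "(\<lambda>k. w k * v k) sums B"
    and sC: "(\<lambda>k. w k * (u k * v k)) sums C"
  shows "\<bar>C - A * B\<bar> \<le> (M - m) * (\<Phi> - \<phi>) / 4"
proof -
  define p where "p = (m + M) / 2"
  have B: "\<phi> \<le> B" "B \<le> \<Phi>"
  proof -
    have "(\<lambda>k. w k * \<phi>) sums \<phi>" "(\<lambda>k. w k * \<Phi>) sums \<Phi>"
      using sums_mult2[OF w(2)] by simp_all
    then show "\<phi> \<le> B" "B \<le> \<Phi>"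
      using sums_le[OF mult_left_mono[OF v(1) w(1)] _ sB]
        sums_le[OF mult_left_mono[OF v(2) w(1)] sB] by blast+
  qed
  have le: "s * (C - A * B) * (\<Phi> - \<phi>) \<le> (M - m) * ((B - \<phi>) * (\<Phi> - B))"
    if s: "\<bar>s\<bar> = 1" for s
  proof -
    \<comment> \<open>\<open>\<Phi> - \<phi>\<close> times the chord of \<open>\<lambda>t. \<bar>t - B\<bar>\<close>, at \<open>v k\<close>\<close>
    define chord where "chord k = (B - \<phi>) * (\<Phi> - v k) + (\<Phi> - B) * (v k - \<phi>)" for k
    \<comment> \<open>the gap in the pointwise bound \<open>nn\<close> below, expanded in \<open>1\<close>, \<open>u\<close>, \<open>v\<close>, \<open>u * v\<close> to take its mean\<close>
    have eq: "w k * ((M - m) * chord k - 2 * s * (\<Phi> - \<phi>) * ((u k - p) * (v k - B)))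
      = ((M - m) * ((B - \<phi>) * \<Phi> - (\<Phi> - B) * \<phi>) - 2 * s * (\<Phi> - \<phi>) * (p * B)) * w k
        + (2 * s * (\<Phi> - \<phi>) * B) * (w k * u k)
        + ((M - m) * (\<Phi> + \<phi> - 2 * B) + 2 * s * (\<Phi> - \<phi>) * p) * (w k * v k)
        - (2 * s * (\<Phi> - \<phi>)) * (w k * (u k * v k))" for k
      unfolding chord_def by (simp add: algebra_simps)
    have sS: "(\<lambda>k. w k * ((M - m) * chord k - 2 * s * (\<Phi> - \<phi>) * ((u k - p) * (v k - B)))) sums
      (((M - m) * ((B - \<phi>) * \<Phi> - (\<Phi> - B) * \<phi>) - 2 * s * (\<Phi> - \<phi>) * (p * B)) * 1
        + (2 * s * (\<Phi> - \<phi>) * B) * A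
        + ((M - m) * (\<Phi> + \<phi> - 2 * B) + 2 * s * (\<Phi> - \<phi>) * p) * B
        - (2 * s * (\<Phi> - \<phi>)) * C)" (is "_ sums ?S")
      unfolding eq by (intro sums_add sums_diff sums_mult w(2) sA sB sC)
    have nn: "0 \<le> w k * ((M - m) * chord k - 2 * s * (\<Phi> - \<phi>) * ((u k - p) * (v k - B)))" for k
    proof -
      have "2 * s * (\<Phi> - \<phi>) * ((u k - p) * (v k - B))
          \<le> \<bar>2 * s * (\<Phi> - \<phi>) * ((u k - p) * (v k - B))\<bar>" by simp
      also have "\<dots> = (2 * \<bar>u k - p\<bar>) * ((\<Phi> - \<phi>) * \<bar>v k - B\<bar>)"
        using s B by (simp add: abs_mult)
      also have "\<dots> \<le> (M - m) * chord k"
      proof (rule mult_mono)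
        show "2 * \<bar>u k - p\<bar> \<le> M - m"
          using u[of k] unfolding p_def by (auto simp: abs_if field_simps)
        show "(\<Phi> - \<phi>) * \<bar>v k - B\<bar> \<le> chord k"
          unfolding chord_def by (intro abs_diff_le_chord v B)
      qed (use u[of k] B in auto)
      finally show ?thesis using w(1)[of k] by simp
    qed
    have "0 \<le> ?S" by (rule sums_le[OF nn sums_zero sS])
    also have "?S = 2 * ((M - m) * ((B - \<phi>) * (\<Phi> - B)) - s * (C - A * B) * (\<Phi> - \<phi>))"
      by (simp add: algebra_simps)
    finally show ?thesis by simp
  qed
  have main: "\<bar>C - A * B\<bar> * (\<Phi> - \<phi>) \<le> (M - m) * (\<Phi> - \<phi>) / 4 * (\<Phi> - \<phi>)"
  proof -
    have "\<bar>C - A * B\<bar> * (\<Phi> - \<phi>) \<le> (M - m) * ((B - \<phi>) * (\<Phi> - B))"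
      using le[of 1] le[of "-1"] by (auto simp: abs_if)
    also have "\<dots> \<le> (M - m) * ((\<Phi> - \<phi>)\<^sup>2 / 4)"
      using u[of 0] by (intro mult_left_mono mult_diff_le_quarter_square) auto
    finally show ?thesis by (simp add: power2_eq_square mult.assoc)
  qed
  show ?thesis
  proof (cases "\<phi> = \<Phi>")
    case True
    \<comment> \<open>here \<open>v\<close> is constant, and the factor \<open>\<Phi> - \<phi>\<close> cannot be cancelled\<close>
    then have "v k = \<phi>" for k using v[of k] by simp
    then have "(\<lambda>k. w k * u k * \<phi>) sums C" using sC by (simp add: mult.assoc)
    moreover have "(\<lambda>k. w k * u k * \<phi>) sums (A * \<phi>)" using sA by (rule sums_mult2)
    ultimately have "C = A * \<phi>" by (rule sums_unique2)
    then show ?thesis using True B by simp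
  next
    case False
    then have "0 < \<Phi> - \<phi>" using B by linarith
    with main show ?thesis by (rule mult_right_le_imp_le)
  qed
qed

lemma geometric_weights_sums:
  fixes q :: real
  assumes "0 < q" "q < 1"
  shows "(\<lambda>k. (1 - q) * q ^ k) sums 1"
  using sums_mult[OF geometric_sums[of q], of "1 - q"] assms by simp

lemma geometric_mean_suminf:
  fixes q S :: real
  assumes "q < 1" "(\<lambda>k. (1 - q) * q ^ k * y k) sums S"
  shows "(1 - q) * (\<Sum>k. y k * q ^ k) = S"
proof -
  have "(\<lambda>k. (1 - q) * (y k * q ^ k)) sums S"
    using assms(2) by (simp add: mult_ac)
  from sums_mult[OF this, of "1 / (1 - q)"] assms(1)
  have "(\<lambda>k. y k * q ^ k) sums (S / (1 - q))" by simp
  then show ?thesis using assms(1) by (simp add: sums_iff)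
qed

text \<open>
  The series is required to converge, since the value of a divergent one is unspecified and
  need not commute with the normalising factor.
\<close>

lemma is_qint_weighted_mean:
  fixes q a b :: real and J :: "(real \<Rightarrow> real) \<Rightarrow> real"
  assumes q: "0 < q" "q < 1" and J: "is_qint q J a b"
  obtains w x :: "nat \<Rightarrow> real"
  where "a < b" "\<And>k. 0 \<le> w k" "w sums 1" "\<And>k. x k \<in> {a..b}"
    "\<And>h S. (\<lambda>k. w k * h (x k)) sums S \<Longrightarrow> J h = (b - a) * S"
  using J
proof cases
  case (G n)
  have qn: "q ^ n < 1" using q G by (simp add: power_less_one_iff)
  \<comment> \<open>the finite sum is padded by zero weights, with the irrelevant nodes placed at \<open>b\<close>\<close>
  define w where "w k = (if k < n then (1 - q) / (1 - q ^ n) * q ^ k else 0)" for k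
  define x where "x k = (if k < n then b * q ^ k else b)" for k
  show ?thesis
  proof (rule that[of w x])
    show "a < b" using G qn by simp
    show "0 \<le> w k" for k using q qn by (simp add: w_def)
    have "w sums (\<Sum>k<n. w k)" by (rule sums_finite) (auto simp: w_def)
    moreover have "(\<Sum>k<n. w k) = (1 - q) / (1 - q ^ n) * (\<Sum>k<n. q ^ k)"
      by (simp add: w_def sum_distrib_left)
    moreover have "\<dots> = 1" using q qn by (simp add: sum_gp_strict)
    ultimately show "w sums 1" by (simp only:)
    show "x k \<in> {a..b}" for k
      using q qn G by (auto simp: x_def power_decreasing power_le_one mult_left_le)
    show "J h = (b - a) * S" if "(\<lambda>k. w k * h (x k)) sums S" for h S
    proof -
      have "(\<lambda>k. w k * h (x k)) sums (\<Sum>k<n. w k * h (x k))"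
        by (rule sums_finite) (auto simp: w_def)
      with that have "S = (\<Sum>k<n. w k * h (x k))" by (rule sums_unique2)
      also have "\<dots> = (1 - q) / (1 - q ^ n) * (\<Sum>k<n. h (b * q ^ k) * q ^ k)"
        by (simp add: w_def x_def sum_distrib_left mult_ac)
      moreover have "b - a = b * (1 - q ^ n)" using G by (simp add: algebra_simps)
      ultimately show ?thesis using G qn by (simp add: G_qint_def)
    qed
  qed
next
  case I
  show ?thesis
  proof (rule that[of "\<lambda>k. (1 - q) * q ^ k" "\<lambda>k. b * q ^ k"])
    show "b * q ^ k \<in> {a..b}" for k
      using q I by (simp add: power_le_one mult_left_le)
    show "J h = (b - a) * S" if "(\<lambda>k. (1 - q) * q ^ k * h (b * q ^ k)) sums S" for h S
      using geometric_mean_suminf[OF q(2) that] I by (simp add: I_qint_def)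
  qed (use q I geometric_weights_sums in auto)
next
  case R
  show ?thesis
  proof (rule that[of "\<lambda>k. (1 - q) * q ^ k" "\<lambda>k. a + (b - a) * q ^ k"])
    show "a + (b - a) * q ^ k \<in> {a..b}" for k
      proof -
      have "(b - a) * q ^ k \<le> b - a" "0 \<le> (b - a) * q ^ k"
        using q R by (auto intro!: mult_left_le power_le_one)
      then show ?thesis by simp
    qed
    show "J h = (b - a) * S" if "(\<lambda>k. (1 - q) * q ^ k * h (a + (b - a) * q ^ k)) sums S" for h S
      using geometric_mean_suminf[OF q(2) that] R by (simp add: R_qint_def)
  qed (use q R geometric_weights_sums in auto)
qed

theorem theorem4p1:
  fixes q a b m M \<phi> \<Phi> :: real
    and J :: "(real \<Rightarrow> real) \<Rightarrow> real"
    and f g :: "real \<Rightarrow> real"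
  assumes "0 < q" and "q < 1"
    and "is_qint q J a b"
    and "\<And>x. x \<in> {a..b} \<Longrightarrow> m \<le> f x \<and> f x \<le> M"
    and "\<And>x. x \<in> {a..b} \<Longrightarrow> \<phi> \<le> g x \<and> g x \<le> \<Phi>"
  shows "\<bar>1 / (b - a) * J (\<lambda>x. f x * g x) - 1 / (b - a)\<^sup>2 * J f * J g\<bar>
           \<le> 1 / 4 * (M - m) * (\<Phi> - \<phi>)"
proof -
  obtain w x :: "nat \<Rightarrow> real" where ab: "a < b"
    and w: "\<And>k. 0 \<le> w k" "w sums 1" and x: "\<And>k. x k \<in> {a..b}"
    and J: "\<And>h S. (\<lambda>k. w k * h (x k)) sums S \<Longrightarrow> J h = (b - a) * S"
    using is_qint_weighted_mean[OF assms(1-3)] by metis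
  have sw: "summable w" using w(2) by (rule sums_summable)
  have fb: "\<bar>f (x k)\<bar> \<le> \<bar>m\<bar> + \<bar>M\<bar>" and gb: "\<bar>g (x k)\<bar> \<le> \<bar>\<phi>\<bar> + \<bar>\<Phi>\<bar>" for k
    using assms(4,5)[OF x[of k]] by linarith+
  have fgb: "\<bar>f (x k) * g (x k)\<bar> \<le> (\<bar>m\<bar> + \<bar>M\<bar>) * (\<bar>\<phi>\<bar> + \<bar>\<Phi>\<bar>)" for k
    unfolding abs_mult by (intro mult_mono fb gb) auto
  obtain A where A: "(\<lambda>k. w k * f (x k)) sums A"
    using summable_mult_bounded[OF w(1) sw fb] unfolding summable_def by (rule exE)
  obtain B where B: "(\<lambda>k. w k * g (x k)) sums B"
    using summable_mult_bounded[OF w(1) sw gb] unfolding summable_def by (rule exE)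
  obtain C where C: "(\<lambda>k. w k * (f (x k) * g (x k))) sums C"
    using summable_mult_bounded[OF w(1) sw fgb] unfolding summable_def by (rule exE)
  have "1 / (b - a) * J (\<lambda>x. f x * g x) - 1 / (b - a)\<^sup>2 * J f * J g = C - A * B"
    using ab by (simp add: J[OF A] J[OF B] J[of "\<lambda>x. f x * g x", OF C] power2_eq_square)
  moreover have "\<bar>C - A * B\<bar> \<le> (M - m) * (\<Phi> - \<phi>) / 4"
    using assms(4,5) x by (intro weighted_Gruss[OF w _ _ _ _ A B C]) auto
  ultimately show ?thesis by simp
qed

end
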